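(* Let $X$ be a compact $\ell_1$-convex subset of $\mathbb{R}^n$ and let $I$ be a compact interval in $\mathbb{R}^n$. Then the set $\{g\in \mathrm{Isom}(\ell_1^n): gX\cap I\neq\emptyset\}$ has measure \[ \sum_{i+j=n}\binom{n}{i}^{-1}V_i(X)V_j(I). \]
   Context: $\ell_1^n$ is $\mathbb{R}^n$ with metric $d(x,y)=\sum_i|x_i-y_i|$. $X$ is $\ell_1$-convex if any two points $x,x'\in X$ are joined by a distance-preserving map $\gamma\colon[0,d(x,x')]\to X$ with $\gamma(0)=x$, $\gamma(d(x,x'))=x'$. An interval in $\mathbb{R}^n$ is a product $I_1\times\cdots\times I_n$ of (possibly empty) intervals in $\mathbb{R}$. $\mathrm{Isom}(\ell_1^n)$ is the isometry group; its subgroup $H_n$ of isometries fixing the origin (the hyperoctahedral group, generated by coordinate permutations and sign changes) is finite, and every isometry is uniquely $x\mapsto h(x)+q$ with $h\in H_n$, $q\in\mathbb{R}^n$. The measure on $\mathrm{Isom}(\ell_1^n)$ is the product of the uniform probability measure on $H_n$ with Lebesgue measure on $\mathbb{R}^n$. $V_i(Y)=\sum_{P\in G_{n,i}}\mathrm{Vol}_i(\pi_PY)$, where $G_{n,i}$ is the set of $i$-dimensional coordinate subspaces (spanned by $i$ standard basis vectors), $\pi_P$ orthogonal projection and $\mathrm{Vol}_i$ Lebesgue measure on $P$. The sum is over $0\le i,j\le n$ with $i+j=n$. *)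

theory Defs
  imports "HOL-Analysis.Analysis"
begin

definition l1dist :: "real^'n \<Rightarrow> real^'n \<Rightarrow> real" where
  "l1dist x y = (\<Sum>i\<in>UNIV. \<bar>x$i - y$i\<bar>)"

definition l1_convex :: "(real^'n) set \<Rightarrow> bool" where
  "l1_convex X \<longleftrightarrow> (\<forall>x\<in>X. \<forall>x'\<in>X. \<exists>\<gamma> :: real \<Rightarrow> real^'n.
      \<gamma> ` {0..l1dist x x'} \<subseteq> X \<and> \<gamma> 0 = x \<and> \<gamma> (l1dist x x') = x' \<and>
      (\<forall>s\<in>{0..l1dist x x'}. \<forall>t\<in>{0..l1dist x x'}. l1dist (\<gamma> s) (\<gamma> t) = \<bar>s - t\<bar>))"

definition hyperoct :: "(real^'n \<Rightarrow> real^'n) set" where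
  "hyperoct = {h. bij h \<and> h 0 = 0 \<and> (\<forall>x y. l1dist (h x) (h y) = l1dist x y)}"

text \<open>Measure on Isom(l1^n): uniform probability on H_n times Lebesgue measure on
  translations, via the unique decomposition g x = h x + q.\<close>
definition isom_measure :: "(real^'n \<Rightarrow> real^'n) set \<Rightarrow> real" where
  "isom_measure A = (1 / real (card (hyperoct :: (real^'n \<Rightarrow> real^'n) set))) *
     (\<Sum>h\<in>hyperoct. measure lebesgue {q :: real^'n. (\<lambda>x. h x + q) \<in> A})"

text \<open>V_i(Y): sum over i-dimensional coordinate subspaces (index sets S with card S = i)
  of the i-dimensional Lebesgue measure of the orthogonal projection of Y,
  the subspace being identified with R^S.\<close>
definition Vi :: "nat \<Rightarrow> (real^'n) set \<Rightarrow> real" where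
  "Vi i Y = (\<Sum>S\<in>{S :: 'n set. card S = i}.
      measure (PiM S (\<lambda>_. lborel)) ((\<lambda>x. restrict (\<lambda>k. x$k) S) ` Y))"

end

(* Fix a signed permutation h. The translates hX + q meeting the box I are those with q in I - hX, and
   a signed permutation of coordinates turns I - hX into X thickened by the permuted half side lengths
   of I. The l1-convexity of X makes every axis-parallel line through a partially thickened projection
   of X meet it in an interval, so by Fubini thickening by c in direction i adds 2c times the volume of
   the projection along i. Iterating over the coordinates expands the volume of I - hX as a sum over
   subsets T of the volume of the projection of X to the complement of T times the product over T of
   the permuted side lengths of I. Averaging that product over all permutations yields the mean over all
   subsets of size card T. Surjective l1-isometries fixing 0 are signed permutations because they
   preserve uniqueness of geodesics, i.e. the pairs of points that differ in at most one coordinate,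
   and hence the coordinate axes. *)
theory Submission
  imports Defs
begin

section \<open>Betweenness in l1-convex sets\<close>

text \<open>Along a geodesic the triangle inequality is an equality; as it also holds in each
  coordinate, it is an equality there too, so the path stays in the coordinate box spanned by
  \<open>x\<close> and \<open>x'\<close>. Each coordinate is 1-Lipschitz along the path, so the
  intermediate value property provides \<open>r\<close>.\<close>

lemma l1_convex_interpolate:
  fixes X :: "(real^'n) set"
  assumes X: "l1_convex X" "x \<in> X" "x' \<in> X" and r: "r \<in> closed_segment (x$i) (x'$i)"
  obtains z where "z \<in> X" "z$i = r" "\<And>k. z$k \<in> closed_segment (x$k) (x'$k)"
proof -
  define d where "d = l1dist x x'"
  obtain \<gamma> where \<gamma>: "\<gamma> ` {0..d} \<subseteq> X" "\<gamma> 0 = x" "\<gamma> d = x'"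
    and iso: "\<And>s t. s \<in> {0..d} \<Longrightarrow> t \<in> {0..d} \<Longrightarrow> l1dist (\<gamma> s) (\<gamma> t) = \<bar>s - t\<bar>"
    using bspec[OF bspec[OF X(1)[unfolded l1_convex_def] X(2)] X(3)] unfolding d_def by auto
  have d0: "d \<ge> 0"
    by (simp add: d_def l1dist_def sum_nonneg)
  have comp: "\<bar>u$k - v$k\<bar> \<le> l1dist u v" for u v :: "real^'n" and k
    unfolding l1dist_def by (rule member_le_sum) auto
  have seg: "\<gamma> t $ k \<in> closed_segment (x$k) (x'$k)" if t: "t \<in> {0..d}" for t k
  proof -
    have "l1dist x (\<gamma> t) + l1dist (\<gamma> t) x' = l1dist x x'"
      using iso[of 0 t] iso[of t d] t d0 \<gamma> by (auto simp: d_def)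
    then have "(\<Sum>k\<in>UNIV. \<bar>x$k - x'$k\<bar>) = (\<Sum>k\<in>UNIV. \<bar>x$k - \<gamma> t$k\<bar> + \<bar>\<gamma> t$k - x'$k\<bar>)"
      by (simp add: l1dist_def sum.distrib)
    then have "\<bar>x$k - x'$k\<bar> = \<bar>x$k - \<gamma> t$k\<bar> + \<bar>\<gamma> t$k - x'$k\<bar>"
      by (rule sum_mono_inv) auto
    then show ?thesis
      by (auto simp: closed_segment_eq_real_ivl)
  qed
  have "continuous_on {0..d} (\<lambda>t. \<gamma> t $ i)"
  proof (rule continuous_on_iff[THEN iffD2], intro ballI allI impI)
    fix t e :: real assume t: "t \<in> {0..d}" and e: "e > 0"
    have "dist (\<gamma> s $ i) (\<gamma> t $ i) \<le> dist s t" if "s \<in> {0..d}" for s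
      using comp[of "\<gamma> s" i "\<gamma> t"] iso[OF that t] by (simp add: dist_real_def)
    then have "\<forall>s\<in>{0..d}. dist s t < e \<longrightarrow> dist (\<gamma> s $ i) (\<gamma> t $ i) < e"
      by fastforce
    with e show "\<exists>\<delta>>0. \<forall>s\<in>{0..d}. dist s t < \<delta> \<longrightarrow> dist (\<gamma> s $ i) (\<gamma> t $ i) < e"
      by blast
  qed
  then have "connected ((\<lambda>t. \<gamma> t $ i) ` {0..d})"
    by (rule connected_continuous_image) simp
  then have "convex ((\<lambda>t. \<gamma> t $ i) ` {0..d})"
    by (simp only: connected_convex_1)
  moreover have "x$i \<in> (\<lambda>t. \<gamma> t $ i) ` {0..d}" "x'$i \<in> (\<lambda>t. \<gamma> t $ i) ` {0..d}"
    using \<gamma>(2,3) d0 by force+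
  ultimately have "closed_segment (x$i) (x'$i) \<subseteq> (\<lambda>t. \<gamma> t $ i) ` {0..d}"
    by (intro closed_segment_subset)
  with r have "r \<in> (\<lambda>t. \<gamma> t $ i) ` {0..d}"
    by (rule subsetD[rotated])
  then obtain t where "t \<in> {0..d}" "\<gamma> t $ i = r"
    by auto
  with seg \<gamma>(1) show thesis
    by (intro that[of "\<gamma> t"]) auto
qed

section \<open>Volumes of thickened projections\<close>

text \<open>\<open>neighbourhood X \<rho> B\<close> is the projection to \<open>\<real>\<^sup>B\<close> of the Minkowski sum of \<open>X\<close> with the
  box \<open>\<Prod>\<^sub>k [-\<rho> k, \<rho> k]\<close>.\<close>
definition neighbourhood :: "(real^'n) set \<Rightarrow> ('n \<Rightarrow> real) \<Rightarrow> 'n set \<Rightarrow> ('n \<Rightarrow> real) set" where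
  "neighbourhood X \<rho> B = {f \<in> extensional B. \<exists>x\<in>X. \<forall>k\<in>B. \<bar>f k - x$k\<bar> \<le> \<rho> k}"

lemma neighbourhood_zero:
  "neighbourhood X (\<lambda>_. 0) B = (\<lambda>x. restrict (\<lambda>k. x$k) B) ` X"
proof (intro equalityI subsetI)
  fix f assume "f \<in> neighbourhood X (\<lambda>_. 0) B"
  then obtain x where "f \<in> extensional B" "x \<in> X" "\<forall>k\<in>B. f k = x$k"
    by (auto simp: neighbourhood_def)
  then have "f = restrict (\<lambda>k. x$k) B"
    by (intro extensionalityI[of _ B]) auto
  with \<open>x \<in> X\<close> show "f \<in> (\<lambda>x. restrict (\<lambda>k. x$k) B) ` X"
    by blast
qed (auto simp: neighbourhood_def)

text \<open>Compact plus closed is closed, so the condition cuts out a closed set \<open>C\<close>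
  of vectors, and the neighbourhood is the preimage of \<open>C\<close> under padding by
  zeros.\<close>

lemma sets_neighbourhood [measurable]:
  fixes X :: "(real^'n) set"
  assumes "compact X"
  shows "neighbourhood X \<rho> B \<in> sets (PiM B (\<lambda>_. lborel))"
proof -
  \<comment> \<open>\<open>U\<close> leaves the coordinates outside \<open>B\<close> free and so may
    be unbounded; closedness of the sum \<open>C\<close> rests on compactness of
    \<open>X\<close>.\<close>
  define U where "U = {u :: real^'n. \<forall>k\<in>B. \<bar>u$k\<bar> \<le> \<rho> k}"
  have "U = (\<Inter>k\<in>B. {u. \<bar>u$k\<bar> \<le> \<rho> k})"
    by (auto simp: U_def)
  then have "closed U"
    by (auto intro!: closed_INT closed_Collect_le continuous_intros)
  define C where "C = (\<Union>x\<in>X. \<Union>u\<in>U. {x + u})"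
  have [measurable]: "C \<in> sets borel"
    unfolding C_def by (intro borel_closed compact_closed_sums assms \<open>closed U\<close>)
  have C: "y \<in> C \<longleftrightarrow> (\<exists>x\<in>X. \<forall>k\<in>B. \<bar>y$k - x$k\<bar> \<le> \<rho> k)" for y
  proof
    assume "\<exists>x\<in>X. \<forall>k\<in>B. \<bar>y$k - x$k\<bar> \<le> \<rho> k"
    then obtain x where "x \<in> X" "y - x \<in> U"
      by (auto simp: U_def)
    then have "x + (y - x) \<in> C"
      unfolding C_def by blast
    then show "y \<in> C"
      by simp
  next
    assume "y \<in> C"
    then obtain x u where "x \<in> X" "u \<in> U" "y = x + u"
      by (auto simp: C_def)
    then show "\<exists>x\<in>X. \<forall>k\<in>B. \<bar>y$k - x$k\<bar> \<le> \<rho> k"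
      by (intro bexI[of _ x]) (auto simp: U_def)
  qed
  \<comment> \<open>The value 0 outside \<open>B\<close> is an arbitrary choice: membership in
    \<open>C\<close> tests only coordinates in \<open>B\<close>.\<close>
  define F :: "('n \<Rightarrow> real) \<Rightarrow> real^'n" where "F f = (\<chi> k. if k \<in> B then f k else 0)" for f
  have [measurable]: "F \<in> PiM B (\<lambda>_. lborel) \<rightarrow>\<^sub>M borel"
  proof (rule borel_measurable_euclidean_space[THEN iffD2], rule ballI)
    fix b :: "real^'n" assume "b \<in> Basis"
    then obtain k where "b = axis k 1"
      by (auto simp: Basis_vec_def)
    then show "(\<lambda>f. F f \<bullet> b) \<in> borel_measurable (PiM B (\<lambda>_. lborel))"
      by (cases "k \<in> B") (auto simp: F_def inner_axis intro: measurable_component_singleton[of _ _ "\<lambda>_. lborel", simplified])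
  qed
  have "neighbourhood X \<rho> B = F -` C \<inter> space (PiM B (\<lambda>_. lborel))"
  proof -
    have "f \<in> neighbourhood X \<rho> B \<longleftrightarrow> f \<in> extensional B \<and> F f \<in> C" for f
      by (simp add: neighbourhood_def C F_def)
    then show ?thesis
      by (auto simp: space_PiM PiE_def)
  qed
  then show ?thesis
    by simp
qed

text \<open>Fubini in direction \<open>i\<close>. By l1-convexity the slice over each
  \<open>g\<close> is empty or an interval; thickening by \<open>c\<close> adds \<open>2 * c\<close>
  to its length in the second case, which occurs exactly when \<open>g\<close> lies in the
  neighbourhood over \<open>B\<close>.\<close>

lemma emeasure_neighbourhood_insert:
  fixes X :: "(real^'n) set"
  assumes X: "compact X" "l1_convex X" and i: "i \<notin> B" and \<rho>: "\<rho> i = 0" and c: "c \<ge> 0"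
  shows "emeasure (PiM (insert i B) (\<lambda>_. lborel)) (neighbourhood X (\<rho>(i := c)) (insert i B)) =
    emeasure (PiM (insert i B) (\<lambda>_. lborel)) (neighbourhood X \<rho> (insert i B)) +
    ennreal (2 * c) * emeasure (PiM B (\<lambda>_. lborel)) (neighbourhood X \<rho> B)"
proof -
  interpret product_sigma_finite "\<lambda>_. lborel :: real measure" ..
  \<comment> \<open>\<open>Z g\<close> collects the \<open>i\<close>-th coordinates of the points of
    \<open>X\<close> compatible with \<open>g\<close>, and \<open>L a g\<close> is the length of its
    thickening by \<open>a\<close>. A general \<open>a\<close> serves both \<open>a = 0\<close> and
    \<open>a = c\<close>.\<close>
  define Z where "Z g = (\<lambda>x. x$i) ` {x \<in> X. \<forall>k\<in>B. \<bar>g k - x$k\<bar> \<le> \<rho> k}" for g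
  define L where "L a g = emeasure lborel {t. \<exists>z\<in>Z g. \<bar>t - z\<bar> \<le> a}" for a g
  have slices: "emeasure (PiM (insert i B) (\<lambda>_. lborel)) (neighbourhood X (\<rho>(i := a)) (insert i B))
      = (\<integral>\<^sup>+ g. L a g \<partial>PiM B (\<lambda>_. lborel))"
    and L_measurable: "L a \<in> borel_measurable (PiM B (\<lambda>_. lborel))" for a
  proof -
    let ?N = "neighbourhood X (\<rho>(i := a)) (insert i B)"
    have N [measurable]: "?N \<in> sets (PiM (insert i B) (\<lambda>_. lborel))"
      by (rule sets_neighbourhood[OF X(1)])
    have eq: "(\<integral>\<^sup>+ t. indicator ?N (g(i := t)) \<partial>lborel) = L a g"
      if g: "g \<in> space (PiM B (\<lambda>_. lborel :: real measure))" for g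
    proof -
      have "(\<lambda>t. g(i := t)) \<in> lborel \<rightarrow>\<^sub>M PiM (insert i B) (\<lambda>_. lborel)"
        using g by (intro measurable_fun_upd[where J=B]) auto
      from measurable_sets[OF this N] have "{t. g(i := t) \<in> ?N} \<in> sets lborel"
        by (simp add: vimage_def)
      moreover have "indicator ?N (g(i := t)) = (indicator {t. g(i := t) \<in> ?N} t :: ennreal)" for t
        by (simp add: indicator_def)
      ultimately have "(\<integral>\<^sup>+ t. indicator ?N (g(i := t)) \<partial>lborel) = emeasure lborel {t. g(i := t) \<in> ?N}"
        by simp
      also have "{t. g(i := t) \<in> ?N} = {t. \<exists>z\<in>Z g. \<bar>t - z\<bar> \<le> a}"
      proof -
        have "g(i := t) \<in> extensional (insert i B)" for t
          using g by (auto simp: space_PiM PiE_def extensional_def)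
        moreover have "(\<forall>k\<in>insert i B. \<bar>(g(i := t)) k - x$k\<bar> \<le> (\<rho>(i := a)) k) \<longleftrightarrow>
            \<bar>t - x$i\<bar> \<le> a \<and> (\<forall>k\<in>B. \<bar>g k - x$k\<bar> \<le> \<rho> k)" for t x
          using i by auto
        ultimately show ?thesis
          unfolding neighbourhood_def Z_def by auto
      qed
      finally show ?thesis
        unfolding L_def .
    qed
    have "emeasure (PiM (insert i B) (\<lambda>_. lborel)) ?N = (\<integral>\<^sup>+ f. indicator ?N f \<partial>PiM (insert i B) (\<lambda>_. lborel))"
      by (rule nn_integral_indicator[OF N, symmetric])
    also have "\<dots> = (\<integral>\<^sup>+ g. \<integral>\<^sup>+ t. indicator ?N (g(i := t)) \<partial>lborel \<partial>PiM B (\<lambda>_. lborel))"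
      by (rule product_nn_integral_insert[OF _ i borel_measurable_indicator[OF N]]) simp
    also have "\<dots> = (\<integral>\<^sup>+ g. L a g \<partial>PiM B (\<lambda>_. lborel))"
      by (rule nn_integral_cong[OF eq])
    finally show "emeasure (PiM (insert i B) (\<lambda>_. lborel)) ?N = (\<integral>\<^sup>+ g. L a g \<partial>PiM B (\<lambda>_. lborel))" .
    have "(\<lambda>g. \<integral>\<^sup>+ t. indicator ?N (g(i := t)) \<partial>lborel) \<in> borel_measurable (PiM B (\<lambda>_. lborel))"
      by measurable
    then show "L a \<in> borel_measurable (PiM B (\<lambda>_. lborel))"
      by (rule measurable_cong[THEN iffD1, rotated]) (rule eq)
  qed
  have step: "L c g = L 0 g + ennreal (2 * c) * indicator (neighbourhood X \<rho> B) g"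
    if g: "g \<in> space (PiM B (\<lambda>_. lborel :: real measure))" for g
  proof -
    have mem: "g \<in> neighbourhood X \<rho> B \<longleftrightarrow> Z g \<noteq> {}"
      using g by (auto simp: neighbourhood_def Z_def space_PiM PiE_def)
    show ?thesis
    proof (cases "Z g = {}")
      case True
      then show ?thesis
        using mem by (simp add: L_def)
    next
      case False
      have "{x \<in> X. \<forall>k\<in>B. \<bar>g k - x$k\<bar> \<le> \<rho> k} = X \<inter> (\<Inter>k\<in>B. {x. \<bar>g k - x$k\<bar> \<le> \<rho> k})"
        by auto
      then have "compact {x \<in> X. \<forall>k\<in>B. \<bar>g k - x$k\<bar> \<le> \<rho> k}"
        by (auto intro!: compact_Int_closed X closed_INT closed_Collect_le continuous_intros)
      then have "compact (Z g)"
        unfolding Z_def by (intro compact_continuous_image continuous_intros)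
      moreover have "connected (Z g)"
        unfolding is_interval_connected_1[symmetric] is_interval_1
      proof (intro ballI allI impI)
        fix p q r assume "p \<in> Z g" "q \<in> Z g" "p \<le> r \<and> r \<le> q"
        then obtain x x' where x: "x \<in> X" "x' \<in> X" "r \<in> closed_segment (x$i) (x'$i)"
          and b: "\<forall>k\<in>B. \<bar>g k - x$k\<bar> \<le> \<rho> k" "\<forall>k\<in>B. \<bar>g k - x'$k\<bar> \<le> \<rho> k"
          by (auto simp: Z_def closed_segment_eq_real_ivl)
        \<comment> \<open>Each coordinate of \<open>z\<close> lies between those of \<open>x\<close>
          and \<open>x'\<close>, so the constraints over \<open>B\<close>, being intervals, are
          inherited by \<open>z\<close>.\<close>
        from x obtain z where z: "z \<in> X" "z$i = r" "\<And>k. z$k \<in> closed_segment (x$k) (x'$k)"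
          using l1_convex_interpolate[OF X(2)] by metis
        have "\<bar>g k - z$k\<bar> \<le> \<rho> k" if "k \<in> B" for k
          using z(3)[of k] b that by (force simp: closed_segment_eq_real_ivl split: if_splits)
        with z show "r \<in> Z g"
          unfolding Z_def by blast
      qed
      ultimately obtain l u where Z: "Z g = {l..u}"
        using connected_compact_interval_1 by (metis box_real(2))
      with False have "l \<le> u"
        by simp
      have L: "L a g = ennreal (u - l + 2 * a)" if "a \<ge> 0" for a
      proof -
        have "{t. \<exists>z\<in>{l..u}. \<bar>t - z\<bar> \<le> a} = {l - a..u + a}"
        proof (intro equalityI subsetI CollectI)
          \<comment> \<open>The witness is the point of \<open>{l..u}\<close> nearest to
            \<open>t\<close>.\<close>
          fix t assume "t \<in> {l - a..u + a}"
          with \<open>l \<le> u\<close> that show "\<exists>z\<in>{l..u}. \<bar>t - z\<bar> \<le> a"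
            by (intro bexI[of _ "max l (min u t)"]) auto
        qed auto
        with \<open>l \<le> u\<close> that show ?thesis
          by (simp add: L_def Z)
      qed
      show ?thesis
        using False mem c \<open>l \<le> u\<close> by (simp add: L flip: ennreal_plus)
    qed
  qed
  have "emeasure (PiM (insert i B) (\<lambda>_. lborel)) (neighbourhood X (\<rho>(i := c)) (insert i B)) =
      (\<integral>\<^sup>+ g. L 0 g + ennreal (2 * c) * indicator (neighbourhood X \<rho> B) g \<partial>PiM B (\<lambda>_. lborel))"
    by (simp add: slices step cong: nn_integral_cong)
  also have "\<dots> = (\<integral>\<^sup>+ g. L 0 g \<partial>PiM B (\<lambda>_. lborel)) +
      ennreal (2 * c) * emeasure (PiM B (\<lambda>_. lborel)) (neighbourhood X \<rho> B)"
    using L_measurable[of 0] sets_neighbourhood[OF X(1), of \<rho> B]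
    by (simp add: nn_integral_add nn_integral_cmult_indicator borel_measurable_times_ennreal)
  \<comment> \<open>Because \<open>\<rho> i = 0\<close>, thickening by \<open>a = 0\<close> gives
    back \<open>\<rho>\<close> itself.\<close>
  also have "(\<integral>\<^sup>+ g. L 0 g \<partial>PiM B (\<lambda>_. lborel)) =
      emeasure (PiM (insert i B) (\<lambda>_. lborel)) (neighbourhood X \<rho> (insert i B))"
    using slices[of 0] \<rho> by (simp add: fun_upd_idem)
  finally show ?thesis .
qed

text \<open>Induction on the set \<open>A\<close> of thickened directions; \<open>T\<close> records
  the directions in which the thickening term is chosen. \<open>B\<close> has to vary, since
  treating direction \<open>i\<close> calls for the hypothesis both at \<open>B\<close> and at
  \<open>B - {i}\<close>.\<close>

lemma emeasure_neighbourhood: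
  fixes X :: "(real^'n) set"
  assumes X: "compact X" "l1_convex X" and \<rho>: "\<And>k. \<rho> k \<ge> 0" and "A \<subseteq> B"
  shows "emeasure (PiM B (\<lambda>_. lborel)) (neighbourhood X (\<lambda>k. if k \<in> A then \<rho> k else 0) B) =
    (\<Sum>T\<in>Pow A. ennreal (\<Prod>k\<in>T. 2 * \<rho> k) *
       emeasure (PiM (B - T) (\<lambda>_. lborel)) (neighbourhood X (\<lambda>_. 0) (B - T)))"
proof -
  have "finite A" by simp
  then show ?thesis
    using \<open>A \<subseteq> B\<close>
  proof (induction A arbitrary: B rule: finite_induct)
    case (insert i A)
    let ?\<rho> = "\<lambda>A k. if k \<in> A then \<rho> k else 0"
    let ?e = "\<lambda>A B. emeasure (PiM B (\<lambda>_. lborel)) (neighbourhood X (?\<rho> A) B)"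
    let ?v = "\<lambda>B. emeasure (PiM B (\<lambda>_. lborel)) (neighbourhood X (\<lambda>_. 0) B)"
    let ?p = "\<lambda>T. ennreal (\<Prod>k\<in>T. 2 * \<rho> k)"
    from insert.prems have B: "insert i (B - {i}) = B" "A \<subseteq> B" "A \<subseteq> B - {i}"
      using insert.hyps by auto
    have upd: "?\<rho> (insert i A) = (?\<rho> A)(i := \<rho> i)"
      by auto
    have "?e (insert i A) B = ?e A B + ennreal (2 * \<rho> i) * ?e A (B - {i})"
      unfolding upd using insert.hyps \<rho>
      by (intro emeasure_neighbourhood_insert[OF X, of i "B - {i}" "?\<rho> A" "\<rho> i", unfolded B(1)]) auto
    also have "\<dots> = (\<Sum>T\<in>Pow A. ?p T * ?v (B - T)) +
        ennreal (2 * \<rho> i) * (\<Sum>T\<in>Pow A. ?p T * ?v (B - {i} - T))"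
      by (simp only: insert.IH[OF B(2)] insert.IH[OF B(3)])
    \<comment> \<open>These become the terms of the enlarged sum whose index set contains
      \<open>i\<close>.\<close>
    also have "ennreal (2 * \<rho> i) * (\<Sum>T\<in>Pow A. ?p T * ?v (B - {i} - T)) =
        (\<Sum>T\<in>Pow A. ?p (insert i T) * ?v (B - insert i T))"
      unfolding sum_distrib_left
    proof (rule sum.cong[OF refl])
      fix T assume "T \<in> Pow A"
      with insert.hyps have "i \<notin> T" by auto
      moreover have "B - {i} - T = B - insert i T" by auto
      ultimately show "ennreal (2 * \<rho> i) * (?p T * ?v (B - {i} - T)) = ?p (insert i T) * ?v (B - insert i T)"
        using \<rho> by (simp add: ennreal_mult prod_nonneg mult_ac)
    qed
    also have "\<dots> = (\<Sum>T\<in>insert i ` Pow A. ?p T * ?v (B - T))"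
      using insert.hyps by (subst sum.reindex) (auto simp: inj_on_def o_def insert_ident subset_iff)
    also have "(\<Sum>T\<in>Pow A. ?p T * ?v (B - T)) + \<dots> = (\<Sum>T\<in>Pow (insert i A). ?p T * ?v (B - T))"
      unfolding Pow_insert using insert.hyps by (intro sum.union_disjoint[symmetric]) auto
    finally show ?case .
  qed auto
qed

text \<open>Finiteness lets the expansion pass from \<open>emeasure\<close> to
  \<open>measure\<close> term by term; a bounding box of \<open>X\<close> provides it.\<close>

lemma emeasure_projection_finite:
  fixes X :: "(real^'n) set"
  assumes "compact X"
  shows "emeasure (PiM B (\<lambda>_. lborel)) (neighbourhood X (\<lambda>_. 0) B) < \<infinity>"
proof -
  interpret product_sigma_finite "\<lambda>_. lborel :: real measure" ..
  obtain a where a: "X \<subseteq> cbox (-a) a"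
    by (rule bounded_subset_cbox_symmetric[OF compact_imp_bounded[OF assms]])
  have "emeasure (PiM B (\<lambda>_. lborel)) (neighbourhood X (\<lambda>_. 0) B)
      \<le> emeasure (PiM B (\<lambda>_. lborel)) (PiE B (\<lambda>k. {-a$k..a$k}))"
    using a by (intro emeasure_mono) (auto simp: neighbourhood_zero mem_box_cart subset_iff intro!: sets_PiM_I_finite)
  also have "\<dots> = (\<Prod>k\<in>B. emeasure lborel {-a$k..a$k})"
    by (rule emeasure_PiM) auto
  also have "\<dots> < \<infinity>"
    by (simp add: emeasure_lborel_Icc_eq prod_ennreal)
  finally show ?thesis .
qed

lemma measure_neighbourhood:
  fixes X :: "(real^'n) set"
  assumes X: "compact X" "l1_convex X" and \<rho>: "\<And>k. \<rho> k \<ge> 0"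
  shows "measure (PiM UNIV (\<lambda>_. lborel)) (neighbourhood X \<rho> UNIV) =
    (\<Sum>T\<in>UNIV. (\<Prod>k\<in>T. 2 * \<rho> k) *
       measure (PiM (-T) (\<lambda>_. lborel)) ((\<lambda>x. restrict (\<lambda>k. x$k) (-T)) ` X))"
proof -
  have fin: "emeasure (PiM (-T) (\<lambda>_. lborel)) (neighbourhood X (\<lambda>_. 0) (-T)) < top" for T
    using emeasure_projection_finite[OF X(1)] by simp
  have "emeasure (PiM UNIV (\<lambda>_. lborel)) (neighbourhood X \<rho> UNIV) =
    (\<Sum>T\<in>UNIV. ennreal (\<Prod>k\<in>T. 2 * \<rho> k) * emeasure (PiM (-T) (\<lambda>_. lborel)) (neighbourhood X (\<lambda>_. 0) (-T)))"
    using emeasure_neighbourhood[OF X \<rho> subset_UNIV, of UNIV] by (simp flip: Compl_eq_Diff_UNIV)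
  then show ?thesis
    unfolding measure_def neighbourhood_zero[symmetric]
    using \<rho> fin by (simp add: enn2real_sum enn2real_mult ennreal_mult_less_top prod_nonneg)
qed

section \<open>Lebesgue measure under signed permutations\<close>

text \<open>Lebesgue measure is determined by its values on boxes, and the preimage of a box is a
  product of intervals with the same side lengths in permuted order. This links the product measure
  on functions to the measure on vectors.\<close>

lemma distr_signed_permutation_lborel:
  fixes \<sigma> :: "'n::finite \<Rightarrow> 'n" and \<epsilon> c :: "'n \<Rightarrow> real"
  assumes \<sigma>: "bij \<sigma>" and \<epsilon>: "\<And>i. \<bar>\<epsilon> i\<bar> = 1"
  shows "distr (PiM UNIV (\<lambda>_. lborel)) borel (\<lambda>f. \<chi> i. \<epsilon> i * f (\<sigma> i) + c i) = (lborel :: (real^'n) measure)"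
    (is "distr ?P _ ?F = _")
    and measurable_signed_permutation:
      "(\<lambda>f. \<chi> i. \<epsilon> i * f (\<sigma> i) + c i) \<in> PiM UNIV (\<lambda>_. lborel) \<rightarrow>\<^sub>M (borel :: (real^'n) measure)"
proof -
  interpret product_sigma_finite "\<lambda>_. lborel :: real measure" ..
  show F [measurable]: "?F \<in> ?P \<rightarrow>\<^sub>M borel"
  proof (rule borel_measurable_euclidean_space[THEN iffD2], rule ballI)
    fix b :: "real^'n" assume "b \<in> Basis"
    then obtain k where b: "b = axis k 1"
      by (auto simp: Basis_vec_def)
    have "(\<lambda>f. f (\<sigma> k)) \<in> ?P \<rightarrow>\<^sub>M lborel"
      by (rule measurable_component_singleton) simp
    then show "(\<lambda>f. ?F f \<bullet> b) \<in> borel_measurable ?P"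
      by (simp add: b inner_axis)
  qed
  show "distr ?P borel ?F = lborel"
  proof (rule lborel_eqI[symmetric])
    fix l u :: "real^'n" assume "\<And>b. b \<in> Basis \<Longrightarrow> l \<bullet> b \<le> u \<bullet> b"
    then have le: "l$i \<le> u$i" for i
      using cart_eq_inner_axis[of l i] cart_eq_inner_axis[of u i] axis_in_Basis_iff[of i "1::real"] by auto
    \<comment> \<open>\<open>J i\<close> solves the \<open>i\<close>-th box condition for the
      argument; a negative sign swaps the endpoints.\<close>
    define J where "J i = (if \<epsilon> i = 1 then {l$i - c i<..<u$i - c i} else {c i - u$i<..<c i - l$i})" for i
    have J: "l$i < \<epsilon> i * t + c i \<and> \<epsilon> i * t + c i < u$i \<longleftrightarrow> t \<in> J i" for i t
      using \<epsilon>[of i] by (cases "\<epsilon> i = 1") (auto simp: J_def abs_if split: if_splits)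
    have emJ: "emeasure lborel (J i) = ennreal (u$i - l$i)" for i
      using le[of i] by (simp add: J_def)
    have "?F -` box l u \<inter> space ?P = PiE UNIV (\<lambda>k. J (inv \<sigma> k))"
    proof -
      have "(\<forall>i. f (\<sigma> i) \<in> J i) \<longleftrightarrow> (\<forall>k. f k \<in> J (inv \<sigma> k))" for f
        using \<sigma> by (metis bij_inv_eq_iff)
      moreover have "?F f \<in> box l u \<longleftrightarrow> (\<forall>i. f (\<sigma> i) \<in> J i)" for f
        by (simp add: mem_box_cart J)
      ultimately show ?thesis
        unfolding space_PiM PiE_UNIV_domain by (simp add: set_eq_iff Pi_iff)
    qed
    then have "emeasure (distr ?P borel ?F) (box l u) = emeasure ?P (PiE UNIV (\<lambda>k. J (inv \<sigma> k)))"
      by (simp add: emeasure_distr)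
    also have "\<dots> = (\<Prod>k\<in>UNIV. emeasure lborel (J (inv \<sigma> k)))"
      by (rule emeasure_PiM) (auto simp: J_def)
    also have "\<dots> = (\<Prod>i\<in>UNIV. ennreal (u$i - l$i))"
      using prod.reindex_bij_betw[OF bij_imp_bij_inv[OF \<sigma>], of "\<lambda>i. ennreal (u$i - l$i)"] by (simp add: emJ)
    also have "\<dots> = ennreal (\<Prod>i\<in>UNIV. u$i - l$i)"
      using le by (simp add: prod_ennreal)
    also have "(\<Prod>i\<in>UNIV. u$i - l$i) = (\<Prod>b\<in>Basis. (u - l) \<bullet> b)"
    proof -
      have Basis: "Basis = (\<lambda>i. axis i 1 :: real^'n) ` UNIV"
        by (auto simp: Basis_vec_def)
      have inj: "inj (\<lambda>i. axis i 1 :: real^'n)"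
        by (simp add: inj_on_def axis_eq_axis)
      show ?thesis
        unfolding Basis by (subst prod.reindex[OF inj]) (simp add: inner_axis)
    qed
    finally show "emeasure (distr ?P borel ?F) (box l u) = (\<Prod>b\<in>Basis. (u - l) \<bullet> b)" .
  qed simp
qed

section \<open>Isometries fixing the origin\<close>

text \<open>A purely metric description of axis-parallel pairs. If two coordinates differ, a
  geodesic may start along either one, giving distinct points at equal distance from
  \<open>x\<close>; if at most one differs, only the segment lies between the points.\<close>

lemma l1dist_collinear_iff:
  fixes x y :: "real^'n"
  shows "(\<forall>z w. l1dist x z + l1dist z y = l1dist x y \<longrightarrow> l1dist x w + l1dist w y = l1dist x y \<longrightarrow>
       l1dist x z = l1dist x w \<longrightarrow> z = w) \<longleftrightarrow> (\<forall>i j. x$i \<noteq> y$i \<longrightarrow> x$j \<noteq> y$j \<longrightarrow> i = j)"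
    (is "?L \<longleftrightarrow> ?R")
proof
  assume L: ?L
  show ?R
  proof (rule ccontr)
    assume "\<not> ?R"
    then obtain i j where ij: "x$i \<noteq> y$i" "x$j \<noteq> y$j" "i \<noteq> j" by auto
    \<comment> \<open>\<open>m\<close> is short enough to be travelled towards \<open>y\<close> in
      either coordinate, so \<open>p i\<close> and \<open>p j\<close> are distinct points between
      \<open>x\<close> and \<open>y\<close>, both at distance \<open>m\<close> from
      \<open>x\<close>.\<close>
    define m where "m = min \<bar>x$i - y$i\<bar> \<bar>x$j - y$j\<bar>"
    have m: "m > 0" "m \<le> \<bar>x$i - y$i\<bar>" "m \<le> \<bar>x$j - y$j\<bar>" using ij by (auto simp: m_def)
    define p where "p k = (\<chi> l. if l = k then x$k + m * sgn (y$k - x$k) else x$l)" for k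
    have p: "l1dist x (p k) = m" "l1dist x (p k) + l1dist (p k) y = l1dist x y"
      if "m \<le> \<bar>x$k - y$k\<bar>" "x$k \<noteq> y$k" for k
    proof -
      have d: "l1dist u v = \<bar>u$k - v$k\<bar> + (\<Sum>l\<in>-{k}. \<bar>u$l - v$l\<bar>)" for u v :: "real^'n"
        unfolding l1dist_def by (simp add: sum.remove[of UNIV k] flip: Compl_eq_Diff_UNIV)
      have s: "(\<Sum>l\<in>-{k}. \<bar>x$l - p k$l\<bar>) = 0" "(\<Sum>l\<in>-{k}. \<bar>p k$l - y$l\<bar>) = (\<Sum>l\<in>-{k}. \<bar>x$l - y$l\<bar>)"
        by (auto simp: p_def intro!: sum.cong sum.neutral)
      have "p k$k = x$k + m * sgn (y$k - x$k)"
        by (simp add: p_def)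
      with that m(1) show "l1dist x (p k) = m" "l1dist x (p k) + l1dist (p k) y = l1dist x y"
        unfolding d s by (auto simp: sgn_if split: if_splits)
    qed
    have "p i = p j"
      using L p[OF m(2) ij(1)] p[OF m(3) ij(2)] by auto
    then have "p i$i = p j$i" by simp
    then show False
      using ij m by (auto simp: p_def sgn_if split: if_splits)
  qed
next
  assume R: ?R
  show ?L
  proof (intro allI impI)
    fix z w
    assume z: "l1dist x z + l1dist z y = l1dist x y" and w: "l1dist x w + l1dist w y = l1dist x y"
      and zw: "l1dist x z = l1dist x w"
    have btw: "\<bar>x$k - y$k\<bar> = \<bar>x$k - v$k\<bar> + \<bar>v$k - y$k\<bar>" if "l1dist x v + l1dist v y = l1dist x y" for v k
    proof -
      from that have "(\<Sum>k\<in>UNIV. \<bar>x$k - y$k\<bar>) = (\<Sum>k\<in>UNIV. \<bar>x$k - v$k\<bar> + \<bar>v$k - y$k\<bar>)"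
        by (simp add: l1dist_def sum.distrib)
      then show ?thesis
        by (rule sum_mono_inv) auto
    qed
    have off: "z$k = w$k" if "x$k = y$k" for k
      using btw[OF z, of k] btw[OF w, of k] that by simp
    show "z = w"
    proof (cases "\<exists>i. x$i \<noteq> y$i")
      case True
      then obtain i where i: "x$i \<noteq> y$i" by blast
      have same: "z$k = w$k" if "k \<noteq> i" for k
        using off R i that by blast
      have d: "l1dist x v = \<bar>x$i - v$i\<bar> + (\<Sum>l\<in>-{i}. \<bar>x$l - v$l\<bar>)" for v :: "real^'n"
        unfolding l1dist_def by (simp add: sum.remove[of UNIV i] flip: Compl_eq_Diff_UNIV)
      have "(\<Sum>l\<in>-{i}. \<bar>x$l - z$l\<bar>) = (\<Sum>l\<in>-{i}. \<bar>x$l - w$l\<bar>)"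
        using same by (intro sum.cong) auto
      then have "\<bar>x$i - z$i\<bar> = \<bar>x$i - w$i\<bar>"
        using zw by (simp add: d)
      \<comment> \<open>Betweenness puts \<open>z$i\<close> and \<open>w$i\<close> on the same side
        of \<open>x$i\<close>, so equal distances force equality.\<close>
      then have "z$i = w$i"
        using btw[OF z, of i] btw[OF w, of i] by (auto simp: abs_if split: if_splits)
      with same show ?thesis
        by (metis vec_eq_iff)
    qed (simp add: vec_eq_iff off)
  qed
qed

text \<open>The metric side of \<open>l1dist_collinear_iff\<close> transfers along \<open>h\<close>:
  surjectivity pulls the quantified points back, and distances are preserved.\<close>

lemma hyperoct_collinear:
  fixes h :: "real^'n \<Rightarrow> real^'n"
  assumes h: "h \<in> hyperoct" and xy: "\<And>i j. x$i \<noteq> y$i \<Longrightarrow> x$j \<noteq> y$j \<Longrightarrow> i = j"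
    and ij: "h x$i \<noteq> h y$i" "h x$j \<noteq> h y$j"
  shows "i = j"
proof -
  have iso: "l1dist (h u) (h v) = l1dist u v" for u v
    using h by (simp add: hyperoct_def)
  have "surj h"
    using h by (simp add: hyperoct_def bij_is_surj)
  have unique: "\<forall>z w. l1dist x z + l1dist z y = l1dist x y \<longrightarrow> l1dist x w + l1dist w y = l1dist x y \<longrightarrow>
       l1dist x z = l1dist x w \<longrightarrow> z = w"
    by (rule l1dist_collinear_iff[THEN iffD2]) (use xy in blast)
  have "\<forall>z w. l1dist (h x) z + l1dist z (h y) = l1dist (h x) (h y) \<longrightarrow>
      l1dist (h x) w + l1dist w (h y) = l1dist (h x) (h y) \<longrightarrow> l1dist (h x) z = l1dist (h x) w \<longrightarrow> z = w"
  proof (intro allI impI)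
    fix z w
    assume zw: "l1dist (h x) z + l1dist z (h y) = l1dist (h x) (h y)"
      "l1dist (h x) w + l1dist w (h y) = l1dist (h x) (h y)" "l1dist (h x) z = l1dist (h x) w"
    obtain z' w' where h': "z = h z'" "w = h w'"
      using surjD[OF \<open>surj h\<close>] by metis
    have "z' = w'"
      using unique[rule_format, of z' w'] zw by (simp add: h' iso)
    then show "z = w"
      by (simp add: h')
  qed
  from l1dist_collinear_iff[THEN iffD1, OF this] ij show ?thesis
    by blast
qed

text \<open>Distances to the points of one axis depend on \<open>x\<close> only through its norm and
  one coordinate; this later recovers the coordinates of \<open>h x\<close>.\<close>

lemma l1dist_axis:
  "l1dist x (axis i t) = l1dist x 0 + \<bar>x$i - t\<bar> - \<bar>x$i\<bar>"
proof -
  have "(\<Sum>k\<in>UNIV. \<bar>x$k - axis i t $ k\<bar>) = \<bar>x$i - t\<bar> + (\<Sum>k\<in>UNIV - {i}. \<bar>x$k\<bar>)"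
    by (subst sum.remove[of _ i]) (auto simp: axis_def intro!: sum.cong)
  moreover have "(\<Sum>k\<in>UNIV. \<bar>x$k\<bar>) = \<bar>x$i\<bar> + (\<Sum>k\<in>UNIV - {i}. \<bar>x$k\<bar>)"
    by (subst sum.remove[of _ i]) auto
  ultimately show ?thesis
    by (simp add: l1dist_def)
qed

text \<open>Any two points of an axis differ in at most one coordinate, hence so do their images. As
  0 is fixed, the images lie on a single axis, and distances to 0 and to the image of the unit
  vector fix the scalar.\<close>

lemma hyperoct_axis:
  fixes h :: "real^'n \<Rightarrow> real^'n"
  assumes h: "h \<in> hyperoct"
  obtains j e where "\<bar>e\<bar> = 1" "\<And>t. h (axis i t) = axis j (e * t)"
proof -
  have iso: "l1dist (h u) (h v) = l1dist u v" for u v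
    using h by (simp add: hyperoct_def)
  have h0: "h 0 = 0"
    using h by (simp add: hyperoct_def)
  have coll: "p = q" if "h (axis i s)$p \<noteq> h (axis i t)$p" "h (axis i s)$q \<noteq> h (axis i t)$q" for s t p q
    by (rule hyperoct_collinear[OF h _ that]) (auto simp: axis_def split: if_splits)
  have single: "\<exists>j. h (axis i t) = axis j (h (axis i t)$j)" for t
  proof -
    have "p = q" if "h (axis i t)$p \<noteq> 0" "h (axis i t)$q \<noteq> 0" for p q
      using coll[of t p 0 q] that h0 by (simp add: axis_eq_0_iff[THEN iffD2])
    then show ?thesis
      by (auto simp: vec_eq_iff axis_def) metis
  qed
  have abs: "\<bar>s - t\<bar> = l1dist (axis j s) (axis j t)" for s t and j :: 'n
    by (simp add: l1dist_axis) (simp add: l1dist_def axis_def if_distrib[of abs] cong: if_cong)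
  obtain j where j: "h (axis i 1) = axis j (h (axis i 1)$j)"
    using single by blast
  define e where "e = h (axis i 1)$j"
  have hj: "h (axis i 1) = axis j e"
    unfolding e_def by (rule j)
  have e: "\<bar>e\<bar> = 1"
    using abs[of e 0 j] abs[of 1 0 i] iso[of "axis i 1" 0] h0 by (simp add: hj axis_eq_0_iff[THEN iffD2])
  have "h (axis i t) = axis j (e * t)" for t
  proof -
    obtain k where k: "h (axis i t) = axis k (h (axis i t)$k)"
      using single by blast
    define v where "v = h (axis i t)$k"
    have hk: "h (axis i t) = axis k v"
      unfolding v_def by (rule k)
    have v: "\<bar>v\<bar> = \<bar>t\<bar>"
      using abs[of v 0 k] abs[of t 0 i] iso[of "axis i t" 0] h0 by (simp add: hk axis_eq_0_iff[THEN iffD2])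
    \<comment> \<open>Otherwise the images of \<open>axis i 1\<close> and \<open>axis i t\<close>
      would differ in both coordinates \<open>j\<close> and \<open>k\<close>.\<close>
    have "k = j" if "t \<noteq> 0"
    proof (rule ccontr)
      assume "k \<noteq> j"
      moreover have "v \<noteq> 0" "e \<noteq> 0"
        using v e that by auto
      ultimately have "h (axis i 1)$k \<noteq> h (axis i t)$k" "h (axis i 1)$j \<noteq> h (axis i t)$j"
        unfolding hj hk by (simp_all add: axis_def)
      from coll[OF this] \<open>k \<noteq> j\<close> show False
        by simp
    qed
    \<comment> \<open>For \<open>t = 0\<close> the index \<open>k\<close> is arbitrary, but then
      \<open>v = 0\<close> and both axis vectors vanish.\<close>
    then have hv: "h (axis i t) = axis j v"
      using hk v by (cases "t = 0") (auto simp: axis_eq_0_iff[THEN iffD2])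
    have "\<bar>v - e\<bar> = \<bar>t - 1\<bar>"
      using abs[of v e j] abs[of t 1 i] iso[of "axis i t" "axis i 1"] by (simp add: hv hj)
    with v e have "v = e * t"
      by (auto simp: abs_if split: if_splits)
    with hv show ?thesis
      by simp
  qed
  with e show thesis
    by (rule that)
qed

text \<open>Boolean signs make the parameters range over a finite set, in bijection with
  \<open>hyperoct\<close>.\<close>

definition signed_perm :: "('n::finite \<Rightarrow> 'n) \<Rightarrow> ('n \<Rightarrow> bool) \<Rightarrow> real^'n \<Rightarrow> real^'n" where
  "signed_perm \<sigma> s x = (\<chi> i. (if s i then 1 else -1) * x$(\<sigma> i))"

lemma signed_perm_hyperoct:
  assumes \<sigma>: "bij \<sigma>"
  shows "signed_perm \<sigma> s \<in> hyperoct"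
proof -
  let ?e = "\<lambda>i. (if s i then 1 else -1) :: real"
  have "bij (signed_perm \<sigma> s)"
  proof (rule bij_betw_byWitness[where f' = "\<lambda>y. \<chi> k. ?e (inv \<sigma> k) * y$(inv \<sigma> k)"])
    show "\<forall>x\<in>UNIV. (\<chi> k. ?e (inv \<sigma> k) * signed_perm \<sigma> s x$(inv \<sigma> k)) = x"
      using \<sigma> by (simp add: signed_perm_def vec_eq_iff bij_is_surj surj_f_inv_f)
    show "\<forall>x\<in>UNIV. signed_perm \<sigma> s (\<chi> k. ?e (inv \<sigma> k) * x$(inv \<sigma> k)) = x"
      using \<sigma> by (simp add: signed_perm_def vec_eq_iff bij_is_inj)
  qed auto
  moreover have "l1dist (signed_perm \<sigma> s x) (signed_perm \<sigma> s y) = l1dist x y" for x y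
  proof -
    have "\<bar>?e i * a - ?e i * b\<bar> = \<bar>a - b\<bar>" for i and a b :: real
      by auto
    then have "l1dist (signed_perm \<sigma> s x) (signed_perm \<sigma> s y) = (\<Sum>i\<in>UNIV. \<bar>x$(\<sigma> i) - y$(\<sigma> i)\<bar>)"
      unfolding l1dist_def signed_perm_def by simp
    also have "\<dots> = l1dist x y"
      unfolding l1dist_def using sum.reindex_bij_betw[OF \<sigma>, of "\<lambda>i. \<bar>x$i - y$i\<bar>"] by simp
    finally show ?thesis .
  qed
  ultimately show ?thesis
    by (simp add: hyperoct_def signed_perm_def vec_eq_iff)
qed

text \<open>The action on the axes determines \<open>h\<close>: each coordinate of
  \<open>h x\<close> can be read off from its distances to the images of axis points. Since
  \<open>\<tau>\<close> sends axes to their images, the permutation of indices is its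
  inverse.\<close>

lemma hyperoct_signed_perm:
  fixes h :: "real^'n \<Rightarrow> real^'n"
  assumes h: "h \<in> hyperoct"
  obtains \<sigma> s where "bij \<sigma>" "h = signed_perm \<sigma> s"
proof -
  have iso: "l1dist (h u) (h v) = l1dist u v" for u v
    using h by (simp add: hyperoct_def)
  have h0: "h 0 = 0" and "inj h"
    using h by (auto simp: hyperoct_def bij_is_inj)
  have "\<exists>p. \<bar>snd p\<bar> = (1::real) \<and> (\<forall>t. h (axis i t) = axis (fst p) (snd p * t))" for i
    using hyperoct_axis[OF h, of i] by (metis fst_conv snd_conv)
  then obtain p where p: "\<And>i. \<bar>snd (p i)\<bar> = (1::real) \<and> (\<forall>t. h (axis i t) = axis (fst (p i)) (snd (p i) * t))"
    by moura
  define \<tau> e where "\<tau> i = fst (p i)" and "e i = snd (p i)" for i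
  have e: "\<bar>e i\<bar> = 1" and ax: "h (axis i t) = axis (\<tau> i) (e i * t)" for i t
    using p by (auto simp: \<tau>_def e_def)
  have "inj \<tau>"
  proof (rule injI)
    fix i j assume "\<tau> i = \<tau> j"
    \<comment> \<open>The scalar \<open>e i * e j\<close> is chosen so that \<open>axis i 1\<close>
      and \<open>axis j (e i * e j)\<close> have the same image.\<close>
    moreover have "e j * (e i * e j) = e i"
      using e[of j] by (auto simp: abs_if split: if_splits)
    ultimately have "h (axis i 1) = h (axis j (e i * e j))"
      by (simp only: ax mult_1_right)
    then have "axis i 1 = (axis j (e i * e j) :: real^'n)"
      using \<open>inj h\<close> by (simp add: inj_eq)
    then show "i = j"
      by (simp add: axis_eq_axis)
  qed
  then have "bij \<tau>"
    by (simp add: bij_def finite_UNIV_inj_surj)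
  have comp: "h x$(\<tau> i) = e i * x$i" for x i
  proof -
    have norm: "l1dist (h x) 0 = l1dist x 0"
      using iso[of x 0] h0 by simp
    have d: "\<bar>h x$(\<tau> i) - e i * t\<bar> - \<bar>h x$(\<tau> i)\<bar> = \<bar>x$i - t\<bar> - \<bar>x$i\<bar>" for t
      using iso[of x "axis i t"] by (simp add: ax l1dist_axis norm)
    \<comment> \<open>Two values of \<open>t\<close> suffice in \<open>d\<close>: the one cancelling
      the first term gives an upper bound for the modulus of the image coordinate, and
      \<open>t = x$i\<close> then gives equality.\<close>
    have "e i * (e i * h x$(\<tau> i)) = h x$(\<tau> i)"
      using e[of i] by (auto simp: abs_if split: if_splits)
    with d[of "e i * h x$(\<tau> i)"] have "\<bar>h x$(\<tau> i)\<bar> \<le> \<bar>x$i\<bar>"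
      by simp
    with d[of "x$i"] have "\<bar>h x$(\<tau> i) - e i * x$i\<bar> \<le> 0"
      by simp
    then show ?thesis
      by simp
  qed
  have "h = signed_perm (inv \<tau>) (\<lambda>k. e (inv \<tau> k) = 1)"
  proof
    fix x
    have "h x$k = (if e (inv \<tau> k) = 1 then 1 else -1) * x$(inv \<tau> k)" for k
      using comp[of x "inv \<tau> k"] e[of "inv \<tau> k"] \<open>bij \<tau>\<close>
      by (auto simp: bij_is_surj surj_f_inv_f abs_if split: if_splits)
    then show "h x = signed_perm (inv \<tau>) (\<lambda>k. e (inv \<tau> k) = 1) x"
      by (simp add: signed_perm_def vec_eq_iff)
  qed
  with bij_imp_bij_inv[OF \<open>bij \<tau>\<close>] show thesis
    by (rule that)
qed

lemma bij_betw_signed_perm_hyperoct: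
  "bij_betw (\<lambda>(\<sigma>, s). signed_perm \<sigma> s) ({\<sigma> :: 'n::finite \<Rightarrow> 'n. bij \<sigma>} \<times> UNIV) hyperoct"
proof (rule bij_betw_imageI)
  show "inj_on (\<lambda>(\<sigma>, s). signed_perm \<sigma> s) ({\<sigma> :: 'n \<Rightarrow> 'n. bij \<sigma>} \<times> UNIV)"
  proof (rule inj_onI, clarify)
    fix \<sigma> \<tau> :: "'n \<Rightarrow> 'n" and s t
    assume eq: "signed_perm \<sigma> s = signed_perm \<tau> t"
    have "\<sigma> i = \<tau> i \<and> s i = t i" for i
      \<comment> \<open>The \<open>i\<close>-th entry of the image of this unit vector is the sign
        given by \<open>s i\<close>; on the right it is nonzero only if
        \<open>\<tau> i = \<sigma> i\<close>.\<close>
      using arg_cong[OF eq, of "\<lambda>h. h (axis (\<sigma> i) 1)$i"]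
      by (auto simp: signed_perm_def axis_def split: if_splits)
    then show "\<sigma> = \<tau> \<and> s = t"
      by auto
  qed
  show "(\<lambda>(\<sigma>, s). signed_perm \<sigma> s) ` ({\<sigma> :: 'n \<Rightarrow> 'n. bij \<sigma>} \<times> UNIV) = hyperoct"
  proof (intro equalityI subsetI)
    fix h :: "real^'n \<Rightarrow> real^'n" assume "h \<in> hyperoct"
    then obtain \<sigma> s where "bij \<sigma>" "h = signed_perm \<sigma> s"
      by (rule hyperoct_signed_perm)
    then show "h \<in> (\<lambda>(\<sigma>, s). signed_perm \<sigma> s) ` ({\<sigma> :: 'n \<Rightarrow> 'n. bij \<sigma>} \<times> UNIV)"
      by force
  qed (auto simp: signed_perm_hyperoct)
qed

section \<open>Averaging over permutations\<close>

text \<open>Permutations act transitively on subsets of a given size, so the left side depends only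
  on \<open>card T\<close>. Summing it over all sets of that size and exchanging the sums gives its
  value.\<close>

lemma sum_permutations_image:
  fixes g :: "'n::finite set \<Rightarrow> real" and T :: "'n set"
  shows "(\<Sum>\<sigma> | bij \<sigma>. g (\<sigma> ` T)) = real (card {\<sigma> :: 'n \<Rightarrow> 'n. bij \<sigma>}) / real (CARD('n) choose card T) *
    (\<Sum>S | card S = card T. g S)"
proof -
  let ?F = "\<lambda>T :: 'n set. \<Sum>\<sigma> | bij \<sigma>. g (\<sigma> ` T)"
  let ?C = "{S :: 'n set. card S = card T}"
  have F: "?F S = ?F T" if "card S = card T" for S
  proof -
    \<comment> \<open>A bijection from \<open>T\<close> to \<open>S\<close> is glued with one
      between the complements.\<close>
    obtain \<tau> where \<tau>: "bij \<tau>" "\<tau> ` T = S"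
    proof -
      obtain p where p: "bij_betw p T S"
        using finite_same_card_bij[OF finite finite \<open>card S = card T\<close>[symmetric]] by blast
      have "card (-T) = card (-S)"
        using \<open>card S = card T\<close> card_Diff_subset[OF finite subset_UNIV, of T] card_Diff_subset[OF finite subset_UNIV, of S]
        by (simp flip: Compl_eq_Diff_UNIV)
      then obtain q where q: "bij_betw q (-T) (-S)"
        using finite_same_card_bij[OF finite finite] by blast
      define \<tau> where "\<tau> x = (if x \<in> T then p x else q x)" for x
      have "bij_betw \<tau> T S" "bij_betw \<tau> (-T) (-S)"
        using p q bij_betw_cong[of T \<tau> p S] bij_betw_cong[of "-T" \<tau> q "-S"] by (simp_all add: \<tau>_def)
      then have "bij_betw \<tau> (T \<union> -T) (S \<union> -S)"
        by (rule bij_betw_combine) auto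
      with \<open>bij_betw \<tau> T S\<close> show thesis
        by (intro that[of \<tau>]) (auto simp: bij_betw_def)
    qed
    have "bij_betw (\<lambda>\<sigma>. \<sigma> \<circ> \<tau>) {\<sigma>. bij \<sigma>} {\<sigma>. bij \<sigma>}"
      using \<tau>(1)
      by (intro bij_betw_byWitness[where f' = "\<lambda>\<sigma>. \<sigma> \<circ> inv \<tau>"])
        (auto simp: bij_comp bij_imp_bij_inv o_assoc[symmetric] bij_is_inj bij_is_surj surj_iff[THEN iffD1])
    from sum.reindex_bij_betw[OF this, of "\<lambda>\<sigma>. g (\<sigma> ` T)"] show ?thesis
      by (simp only: image_comp[symmetric] \<tau>(2))
  qed
  have "(\<Sum>S\<in>?C. g (\<sigma> ` S)) = (\<Sum>S\<in>?C. g S)" if "bij \<sigma>" for \<sigma>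
  proof -
    have card: "card (\<tau> ` S) = card S" if "bij \<tau>" for \<tau> :: "'n \<Rightarrow> 'n" and S
      by (rule card_image[OF inj_on_subset[OF bij_is_inj[OF that] subset_UNIV]])
    have "bij_betw (image \<sigma>) ?C ?C"
    proof (rule bij_betw_byWitness[where f' = "image (inv \<sigma>)"])
      show "\<forall>S\<in>?C. inv \<sigma> ` \<sigma> ` S = S" "\<forall>S\<in>?C. \<sigma> ` inv \<sigma> ` S = S"
        using that by (simp_all add: image_inv_f_f image_f_inv_f bij_is_inj bij_is_surj)
    qed (auto simp: card that bij_imp_bij_inv)
    then show ?thesis
      by (rule sum.reindex_bij_betw)
  qed
  then have "real (card {\<sigma> :: 'n \<Rightarrow> 'n. bij \<sigma>}) * (\<Sum>S\<in>?C. g S) = (\<Sum>\<sigma> | bij \<sigma>. \<Sum>S\<in>?C. g (\<sigma> ` S))"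
    by simp
  also have "\<dots> = (\<Sum>S\<in>?C. ?F S)"
    by (rule sum.swap)
  also have "\<dots> = (\<Sum>S\<in>?C. ?F T)"
    by (intro sum.cong[OF refl] F) simp
  also have "\<dots> = real (card ?C) * ?F T"
    by simp
  also have "card ?C = CARD('n) choose card T"
    using n_subsets[of "UNIV :: 'n set" "card T"] by simp
  finally show ?thesis
    \<comment> \<open>The bound on \<open>card T\<close> makes the binomial coefficient nonzero, so
      it can be divided out.\<close>
    using card_mono[OF finite subset_UNIV, of T] by (simp add: divide_simps mult.commute)
qed

section \<open>Boxes and the hitting measure\<close>

lemma Vi_cbox:
  fixes a b :: "real^'n"
  assumes "\<And>k. a$k \<le> b$k"
  shows "Vi j (cbox a b) = (\<Sum>S | card S = j. \<Prod>k\<in>S. b$k - a$k)"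
  unfolding Vi_def
proof (rule sum.cong[OF refl])
  fix S :: "'n set"
  interpret product_sigma_finite "\<lambda>_. lborel :: real measure" ..
  have "(\<lambda>x. restrict (\<lambda>k. x$k) S) ` cbox a b = PiE S (\<lambda>k. {a$k..b$k})"
  proof (intro equalityI subsetI)
    fix f assume f: "f \<in> PiE S (\<lambda>k. {a$k..b$k})"
    let ?x = "\<chi> k. if k \<in> S then f k else a$k"
    have "?x \<in> cbox a b"
      using f assms by (auto simp: mem_box_cart PiE_def Pi_def)
    moreover have "f = restrict (\<lambda>k. ?x$k) S"
      using f by (intro extensionalityI[of _ S]) (auto simp: PiE_def)
    ultimately show "f \<in> (\<lambda>x. restrict (\<lambda>k. x$k) S) ` cbox a b"
      by blast
  qed (auto simp: mem_box_cart)
  moreover have "emeasure (PiM S (\<lambda>_. lborel)) (PiE S (\<lambda>k. {a$k..b$k})) = (\<Prod>k\<in>S. ennreal (b$k - a$k))"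
    using assms by (subst emeasure_PiM) auto
  ultimately show "measure (PiM S (\<lambda>_. lborel)) ((\<lambda>x. restrict (\<lambda>k. x$k) S) ` cbox a b) =
      (\<Prod>k\<in>S. b$k - a$k)"
    using assms by (simp add: measure_def prod_ennreal prod_nonneg)
qed

text \<open>The measure-preserving substitution \<open>q = F f\<close> turns the set of hitting
  translations into the neighbourhood of \<open>X\<close> whose radii are the permuted half side
  lengths of the box.\<close>

lemma measure_signed_perm_hitting:
  fixes X :: "(real^'n) set" and a b :: "real^'n"
  assumes X: "compact X" "l1_convex X" and ab: "\<And>k. a$k \<le> b$k" and \<sigma>: "bij \<sigma>"
  shows "measure lebesgue {q. (\<lambda>x. signed_perm \<sigma> s x + q) ` X \<inter> cbox a b \<noteq> {}} =
    (\<Sum>T\<in>UNIV. (\<Prod>k\<in>inv \<sigma> ` T. b$k - a$k) *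
       measure (PiM (-T) (\<lambda>_. lborel)) ((\<lambda>x. restrict (\<lambda>k. x$k) (-T)) ` X))"
proof -
  let ?Q = "{q. (\<lambda>x. signed_perm \<sigma> s x + q) ` X \<inter> cbox a b \<noteq> {}}"
  let ?P = "PiM UNIV (\<lambda>_. lborel) :: ('n \<Rightarrow> real) measure"
  define \<epsilon> :: "'n \<Rightarrow> real" where "\<epsilon> i = (if s i then 1 else -1)" for i
  \<comment> \<open>\<open>F f\<close> is the centre of the box minus the signed permutation of
    \<open>f\<close>, so that \<open>signed_perm \<sigma> s x + F f\<close> differs from the centre
    by the signed permutation of \<open>x - f\<close>.\<close>
  define F :: "('n \<Rightarrow> real) \<Rightarrow> real^'n" where
    "F f = (\<chi> i. - \<epsilon> i * f (\<sigma> i) + (a$i + b$i) / 2)" for f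
  have \<epsilon>: "\<bar>- \<epsilon> i\<bar> = 1" for i
    by (simp add: \<epsilon>_def)
  have F: "distr ?P borel F = lborel" and [measurable]: "F \<in> ?P \<rightarrow>\<^sub>M borel"
    unfolding F_def[abs_def]
    using distr_signed_permutation_lborel[of \<sigma> "\<lambda>i. - \<epsilon> i" "\<lambda>i. (a$i + b$i) / 2", OF \<sigma> \<epsilon>]
      measurable_signed_permutation[of \<sigma> "\<lambda>i. - \<epsilon> i" "\<lambda>i. (a$i + b$i) / 2", OF \<sigma> \<epsilon>] by auto
  define \<rho> where "\<rho> k = (b$(inv \<sigma> k) - a$(inv \<sigma> k)) / 2" for k
  have \<rho>2: "2 * \<rho> k = b$(inv \<sigma> k) - a$(inv \<sigma> k)" for k
    by (simp add: \<rho>_def)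
  have \<rho>: "\<rho> k \<ge> 0" for k
    using ab by (simp add: \<rho>_def)
  have box: "(\<Prod>k\<in>T. 2 * \<rho> k) = (\<Prod>k\<in>inv \<sigma> ` T. b$k - a$k)" for T
    by (subst prod.reindex)
      (auto simp: \<rho>2 intro: inj_on_subset[OF bij_is_inj[OF bij_imp_bij_inv[OF \<sigma>]] subset_UNIV])
  \<comment> \<open>As a continuous image of a compact set, \<open>?Q\<close> is Borel, so its
    \<open>lebesgue\<close> and \<open>lborel\<close> measures agree.\<close>
  have "?Q = (\<lambda>(x, y). y - signed_perm \<sigma> s x) ` (X \<times> cbox a b)"
  proof (intro equalityI subsetI)
    fix q assume "q \<in> ?Q"
    then obtain x where "x \<in> X" "signed_perm \<sigma> s x + q \<in> cbox a b"
      by auto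
    then show "q \<in> (\<lambda>(x, y). y - signed_perm \<sigma> s x) ` (X \<times> cbox a b)"
      by (intro image_eqI[of _ _ "(x, signed_perm \<sigma> s x + q)"]) auto
  qed force
  moreover have "compact ((\<lambda>(x, y). y - signed_perm \<sigma> s x) ` (X \<times> cbox a b))"
    unfolding signed_perm_def case_prod_beta
    by (intro compact_continuous_image compact_Times X compact_cbox continuous_intros)
  ultimately have Q [measurable]: "?Q \<in> sets borel"
    by (simp add: borel_compact)
  have "\<bar>f (\<sigma> i) - x$(\<sigma> i)\<bar> \<le> \<rho> (\<sigma> i) \<longleftrightarrow>
      a$i \<le> (signed_perm \<sigma> s x + F f)$i \<and> (signed_perm \<sigma> s x + F f)$i \<le> b$i" for f x i
    unfolding abs_le_iff using \<sigma>
    by (auto simp: \<rho>_def F_def \<epsilon>_def signed_perm_def bij_is_inj field_simps)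
  moreover have "(\<forall>k. \<bar>f k - x$k\<bar> \<le> \<rho> k) \<longleftrightarrow> (\<forall>i. \<bar>f (\<sigma> i) - x$(\<sigma> i)\<bar> \<le> \<rho> (\<sigma> i))" for f x
    using bij_is_surj[OF \<sigma>] by (metis surjD)
  ultimately have "signed_perm \<sigma> s x + F f \<in> cbox a b \<longleftrightarrow> (\<forall>k. \<bar>f k - x$k\<bar> \<le> \<rho> k)" for f x
    by (simp add: mem_box_cart)
  moreover have "F f \<in> ?Q \<longleftrightarrow> (\<exists>x\<in>X. signed_perm \<sigma> s x + F f \<in> cbox a b)" for f
    by auto
  ultimately have "F f \<in> ?Q \<longleftrightarrow> f \<in> neighbourhood X \<rho> UNIV" for f
    by (simp add: neighbourhood_def)
  then have "F -` ?Q \<inter> space ?P = neighbourhood X \<rho> UNIV"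
    by (simp add: set_eq_iff space_PiM)
  then have "measure ?P (neighbourhood X \<rho> UNIV) = measure (distr ?P borel F) ?Q"
    by (simp add: measure_distr)
  then have "measure lebesgue ?Q = measure ?P (neighbourhood X \<rho> UNIV)"
    by (simp add: F measure_completion)
  also have "\<dots> = (\<Sum>T\<in>UNIV. (\<Prod>k\<in>T. 2 * \<rho> k) *
       measure (PiM (-T) (\<lambda>_. lborel)) ((\<lambda>x. restrict (\<lambda>k. x$k) (-T)) ` X))"
    by (rule measure_neighbourhood[OF X \<rho>])
  also have "\<dots> = (\<Sum>T\<in>UNIV. (\<Prod>k\<in>inv \<sigma> ` T. b$k - a$k) *
       measure (PiM (-T) (\<lambda>_. lborel)) ((\<lambda>x. restrict (\<lambda>k. x$k) (-T)) ` X))"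
    by (simp only: box)
  finally show ?thesis .
qed

theorem theorem8p3:
  fixes X I :: "(real^'n) set"
  assumes "compact X" and "l1_convex X"
    and "\<exists>a b. I = cbox a b"
  shows "isom_measure {g :: real^'n \<Rightarrow> real^'n. g ` X \<inter> I \<noteq> {}} =
    (\<Sum>i\<in>{0..CARD('n)}. (1 / real (CARD('n) choose i)) * Vi i X * Vi (CARD('n) - i) I)"
proof (cases "I = {}")
  \<comment> \<open>Treated apart because side lengths \<open>b$k - a$k\<close> describe only
    nonempty boxes; here both sides vanish.\<close>
  case True
  then show ?thesis
    by (simp add: isom_measure_def Vi_def)
next
  case False
  with assms(3) obtain a b where I: "I = cbox a b" and "cbox a b \<noteq> {}"
    by auto
  then have ab: "a$k \<le> b$k" for k
    by (simp add: interval_ne_empty_cart)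
  let ?n = "CARD('n)"
  let ?B = "{\<sigma> :: 'n \<Rightarrow> 'n. bij \<sigma>}"
  let ?H = "hyperoct :: (real^'n \<Rightarrow> real^'n) set"
  let ?S = "UNIV :: ('n \<Rightarrow> bool) set"
  define v where "v S = measure (PiM S (\<lambda>_. lborel)) ((\<lambda>x. restrict (\<lambda>k. x$k) S) ` X)" for S
  define g where "g T = (\<Prod>k\<in>T. b$k - a$k)" for T
  have card_H: "card ?H = card ?B * card ?S"
    by (subst bij_betw_same_card[OF bij_betw_signed_perm_hyperoct, symmetric]) (rule card_cartesian_product)
  have "id \<in> ?B"
    by simp
  then have B: "card ?B > 0" "card ?S > 0"
    by (auto simp: card_gt_0_iff)
  have "(\<Sum>h\<in>?H. measure lebesgue {q. (\<lambda>x. h x + q) ` X \<inter> I \<noteq> {}}) =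
      (\<Sum>(\<sigma>, s)\<in>?B \<times> ?S. measure lebesgue {q. (\<lambda>x. signed_perm \<sigma> s x + q) ` X \<inter> I \<noteq> {}})"
    using sum.reindex_bij_betw[OF bij_betw_signed_perm_hyperoct,
        of "\<lambda>h. measure lebesgue {q. (\<lambda>x. h x + q) ` X \<inter> I \<noteq> {}}"]
    by (simp add: case_prod_beta)
  also have "\<dots> = (\<Sum>(\<sigma>, s)\<in>?B \<times> ?S. \<Sum>T\<in>UNIV. g (inv \<sigma> ` T) * v (-T))"
    by (intro sum.cong refl) (auto simp: I g_def v_def measure_signed_perm_hitting[OF assms(1,2) ab])
  \<comment> \<open>The summand is the same for all choices of signs, which contributes the factor
    \<open>card ?S\<close>.\<close>
  also have "\<dots> = real (card ?S) * (\<Sum>\<sigma>\<in>?B. \<Sum>T\<in>UNIV. g (inv \<sigma> ` T) * v (-T))"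
    by (simp add: sum.cartesian_product[symmetric] sum_distrib_left)
  also have "(\<Sum>\<sigma>\<in>?B. \<Sum>T\<in>UNIV. g (inv \<sigma> ` T) * v (-T)) = (\<Sum>T\<in>UNIV. (\<Sum>\<sigma>\<in>?B. g (inv \<sigma> ` T)) * v (-T))"
    by (subst sum.swap) (simp add: sum_distrib_right)
  also have "\<dots> = (\<Sum>T\<in>UNIV. (\<Sum>\<sigma>\<in>?B. g (\<sigma> ` T)) * v (-T))"
  proof -
    have "bij_betw inv ?B ?B"
      by (rule bij_betw_byWitness[where f' = inv]) (auto simp: inv_inv_eq bij_imp_bij_inv)
    from sum.reindex_bij_betw[OF this, of "\<lambda>\<sigma>. g (\<sigma> ` T)" for T] show ?thesis
      by simp
  qed
  \<comment> \<open>After complementation \<open>T\<close> indexes the projection of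
    \<open>X\<close>, so grouping by \<open>card T\<close> will produce
    \<open>Vi i X\<close>.\<close>
  also have "\<dots> = (\<Sum>T\<in>UNIV. (\<Sum>\<sigma>\<in>?B. g (\<sigma> ` (-T))) * v T)"
    by (rule sum.reindex_bij_witness[where i = uminus and j = uminus]) auto
  also have "\<dots> = (\<Sum>i\<in>{0..?n}. \<Sum>T | card T = i. (\<Sum>\<sigma>\<in>?B. g (\<sigma> ` (-T))) * v T)"
    using sum.group[of "UNIV :: 'n set set" "{0..?n}" card "\<lambda>T. (\<Sum>\<sigma>\<in>?B. g (\<sigma> ` (-T))) * v T"]
    by (simp add: card_mono image_subset_iff)
  also have "\<dots> = (\<Sum>i\<in>{0..?n}. real (card ?B) / real (?n choose i) * Vi i X * Vi (?n - i) I)"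
  proof (rule sum.cong[OF refl])
    fix i assume i: "i \<in> {0..?n}"
    have "(\<Sum>T | card T = i. (\<Sum>\<sigma>\<in>?B. g (\<sigma> ` (-T))) * v T) =
        (\<Sum>T | card T = i. real (card ?B) / real (?n choose i) * Vi (?n - i) I * v T)"
    proof (rule sum.cong[OF refl])
      fix T :: "'n set" assume "T \<in> {T. card T = i}"
      then have "card (-T) = ?n - i"
        using card_Diff_subset[OF finite subset_UNIV, of T] by (simp flip: Compl_eq_Diff_UNIV)
      \<comment> \<open>Averaging over sets of size \<open>?n - i\<close> produces this coefficient;
        symmetry brings it to the stated form.\<close>
      moreover have "?n choose (?n - i) = ?n choose i"
        using i by (intro binomial_symmetric[symmetric]) simp
      ultimately show "(\<Sum>\<sigma>\<in>?B. g (\<sigma> ` (-T))) * v T = real (card ?B) / real (?n choose i) * Vi (?n - i) I * v T"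
        using sum_permutations_image[of g "-T"] Vi_cbox[OF ab, of "?n - i"] by (simp add: I g_def)
    qed
    also have "\<dots> = real (card ?B) / real (?n choose i) * Vi (?n - i) I * Vi i X"
      by (simp only: sum_distrib_left Vi_def v_def)
    finally show "(\<Sum>T | card T = i. (\<Sum>\<sigma>\<in>?B. g (\<sigma> ` (-T))) * v T) =
        real (card ?B) / real (?n choose i) * Vi i X * Vi (?n - i) I"
      by (simp add: mult_ac)
  qed
  finally have "(\<Sum>h\<in>?H. measure lebesgue {q. (\<lambda>x. h x + q) ` X \<inter> I \<noteq> {}}) =
      real (card ?H) * (\<Sum>i\<in>{0..?n}. (1 / real (?n choose i)) * Vi i X * Vi (?n - i) I)"
    unfolding card_H by (simp add: sum_distrib_left mult_ac)
  moreover have "real (card ?H) > 0"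
    using B by (simp add: card_H)
  ultimately show ?thesis
    by (simp add: isom_measure_def)
qed

end
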